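(* Let $\lambda,\mu$ be partitions. If $a_\lambda^\mu>0$, then $|\lambda\cap\mu|\ge 2|\mu|-|\lambda|$.
   Context: For a partition $\mu$ with $|\mu|=n$, $V_\mu$ is the Specht module of $\mathfrak S_n$; $\mathbb{S}^\lambda$ is the Schur functor over $\mathbb{C}$; $r_\lambda^\mu=\dim\operatorname{Hom}_{\mathfrak S_n}(V_\mu,\mathbb{S}^\lambda\mathbb{C}^n)$ with $n=|\mu|$ and $\mathfrak S_n$ acting on $\mathbb{C}^n$ by permutation matrices. For a partition $\mu=(\mu_1,\dots,\mu_\ell)$ and $n\ge\mu_1+|\mu|$, put $\mu^{(n)}=(n-|\mu|,\mu_1,\dots,\mu_\ell)$. The stable restriction coefficient is $a_\lambda^\mu=\lim_{n\to\infty}r_\lambda^{\mu^{(n)}}$ (the limit exists). $\lambda\cap\mu$ is the partition with $(\lambda\cap\mu)_i=\min(\lambda_i,\mu_i)$. *)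

theory Defs
  imports "HOL-Combinatorics.Permutations" "HOL-Library.Function_Algebras" Complex_Main
begin

definition is_partition :: "nat list \<Rightarrow> bool" where
  "is_partition l \<longleftrightarrow> sorted_wrt (\<ge>) l \<and> 0 \<notin> set l"

text \<open>lambda cap mu : componentwise minimum (missing parts are 0).\<close>
definition pinter :: "nat list \<Rightarrow> nat list \<Rightarrow> nat list" where
  "pinter l m = map2 min l m"

definition pad_part :: "nat \<Rightarrow> nat list \<Rightarrow> nat list" where
  "pad_part n m = (n - sum_list m) # m"

section \<open>Young symmetrizers (Fulton--Harris conventions)\<close>

text \<open>Cells of the Young diagram, listed in row reading order; the canonical tableau
  puts entry k (0-based) into cell number k.\<close>
definition cells :: "nat list \<Rightarrow> (nat \<times> nat) list" where
  "cells l = concat (map (\<lambda>i. map (\<lambda>j. (i, j)) [0..<l ! i]) [0..<length l])"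

definition perms :: "nat \<Rightarrow> (nat \<Rightarrow> nat) set" where
  "perms n = {p. p permutes {..<n}}"

definition row_group :: "nat list \<Rightarrow> (nat \<Rightarrow> nat) set" where
  "row_group l = {p \<in> perms (sum_list l).
     \<forall>k < sum_list l. fst (cells l ! p k) = fst (cells l ! k)}"

definition col_group :: "nat list \<Rightarrow> (nat \<Rightarrow> nat) set" where
  "col_group l = {p \<in> perms (sum_list l).
     \<forall>k < sum_list l. snd (cells l ! p k) = snd (cells l ! k)}"

text \<open>Elements of the group algebra C[S_n] are functions on permutations of {..<n}.
  Young symmetrizer c_l = a_l b_l = sum over row perms r and column perms q of sign(q) r q.\<close>
definition young_sym :: "nat list \<Rightarrow> (nat \<Rightarrow> nat) \<Rightarrow> complex" where
  "young_sym l = (\<lambda>\<pi>. \<Sum>r\<in>row_group l. \<Sum>q\<in>col_group l.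
      if r \<circ> q = \<pi> then of_int (sign q) else 0)"

definition conv :: "nat \<Rightarrow> ((nat \<Rightarrow> nat) \<Rightarrow> complex) \<Rightarrow> ((nat \<Rightarrow> nat) \<Rightarrow> complex)
                     \<Rightarrow> ((nat \<Rightarrow> nat) \<Rightarrow> complex)" where
  "conv n x y = (\<lambda>\<pi>. \<Sum>\<sigma>\<in>perms n. x \<sigma> * y (inv \<sigma> \<circ> \<pi>))"

definition specht :: "nat list \<Rightarrow> ((nat \<Rightarrow> nat) \<Rightarrow> complex) set" where
  "specht m = range (\<lambda>x. conv (sum_list m) x (young_sym m))"

definition act_alg :: "(nat \<Rightarrow> nat) \<Rightarrow> ((nat \<Rightarrow> nat) \<Rightarrow> complex) \<Rightarrow> ((nat \<Rightarrow> nat) \<Rightarrow> complex)" where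
  "act_alg \<sigma> x = (\<lambda>\<pi>. x (inv \<sigma> \<circ> \<pi>))"

text \<open>(C^n)^{tensor d}: coordinate functions on words u : {..<d} -> {..<n}
  (the coefficient of e_{u 0} (x) ... (x) e_{u (d-1)}); zero off the words.\<close>
definition words :: "nat \<Rightarrow> nat \<Rightarrow> (nat \<Rightarrow> nat) set" where
  "words d n = {..<d} \<rightarrow>\<^sub>E {..<n}"

text \<open>Schur functor S^lambda C^n = image of the right action of c_lambda on (C^n)^{tensor d},
  d = |lambda|, where (v_1 (x) ... (x) v_d) . tau = v_{tau 1} (x) ... (x) v_{tau d}.\<close>
definition schur :: "nat list \<Rightarrow> nat \<Rightarrow> ((nat \<Rightarrow> nat) \<Rightarrow> complex) set" where
  "schur l n = range (\<lambda>t. \<lambda>u. if u \<in> words (sum_list l) n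
      then (\<Sum>\<tau>\<in>perms (sum_list l). young_sym l \<tau> * t (restrict (u \<circ> inv \<tau>) {..<sum_list l}))
      else 0)"

text \<open>S_n acts on C^n by permutation matrices (e_i -> e_{sigma i}), diagonally on tensors.\<close>
definition act_tens :: "nat \<Rightarrow> nat \<Rightarrow> (nat \<Rightarrow> nat) \<Rightarrow> ((nat \<Rightarrow> nat) \<Rightarrow> complex)
                         \<Rightarrow> ((nat \<Rightarrow> nat) \<Rightarrow> complex)" where
  "act_tens d n \<sigma> t = (\<lambda>u. if u \<in> words d n then t (restrict (inv \<sigma> \<circ> u) {..<d}) else 0)"

text \<open>Hom_{S_n}(V_mu, S^lambda C^n): S_n-equivariant C-linear maps V_mu -> S^lambda C^n,
  normalised to be 0 outside V_mu (so each homomorphism has a unique representative).\<close>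
definition hom_space :: "nat list \<Rightarrow> nat list
     \<Rightarrow> (((nat \<Rightarrow> nat) \<Rightarrow> complex) \<Rightarrow> ((nat \<Rightarrow> nat) \<Rightarrow> complex)) set" where
  "hom_space l m = (let n = sum_list m; d = sum_list l; V = specht m; W = schur l n in
     {f. (\<forall>x\<in>V. \<forall>y\<in>V. f (x + y) = f x + f y)
       \<and> (\<forall>c::complex. \<forall>x\<in>V. f (\<lambda>\<pi>. c * x \<pi>) = (\<lambda>u. c * f x u))
       \<and> f ` V \<subseteq> W
       \<and> (\<forall>\<sigma>\<in>perms n. \<forall>x\<in>V. f (act_alg \<sigma> x) = act_tens d n \<sigma> (f x))
       \<and> (\<forall>x. x \<notin> V \<longrightarrow> f x = 0)})"

definition restr_coeff :: "nat list \<Rightarrow> nat list \<Rightarrow> nat" where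
  "restr_coeff l m = vector_space.dim
     (\<lambda>(c::complex) (f :: ((nat \<Rightarrow> nat) \<Rightarrow> complex) \<Rightarrow> ((nat \<Rightarrow> nat) \<Rightarrow> complex)). (\<lambda>x u. c * f x u))
     (hom_space l m)"

definition stable_coeff :: "nat list \<Rightarrow> nat list \<Rightarrow> real" where
  "stable_coeff l m = lim (\<lambda>n. real (restr_coeff l (pad_part n m)))"

end

theory Submission
  imports Defs
begin

text \<open>
  Write \<open>\<nu> = \<mu>\<^sup>(\<^sup>n\<^sup>)\<close>, \<open>d = |\<lambda>|\<close>, and regard tensors as functions on words \<open>u : [d] \<rightarrow> [n]\<close>, with the
  \<open>n\<close> labels filled into the diagram of \<open>\<nu>\<close> and the \<open>d\<close> positions into that of \<open>\<lambda>\<close>. The image \<open>v\<close> of the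
  Young symmetrizer under a nonzero homomorphism, row-symmetrized over the positions, is a nonzero
  function \<open>w\<close> that is symmetric under row permutations of labels and of positions and satisfies a
  Garnir relation on each side; these say that \<open>w\<close> is a highest weight vector of weight \<open>(\<nu>, \<lambda>)\<close> in
  \<open>Sym\<^sup>n(\<complex>\<^sup>\<infinity> \<otimes> Sym \<complex>\<^sup>\<infinity>)\<close>.

  A suitable leading word \<open>u\<close> in the support of \<open>w\<close> then uses every label outside the first row of \<open>\<nu>\<close>,
  and each such label in row \<open>i + 1\<close> of \<open>\<nu>\<close> (row \<open>i\<close> of \<open>\<mu>\<close>) that is used exactly once sits at a position in
  row \<open>i\<close> of \<open>\<lambda>\<close>. Hence the number \<open>s\<close> of labels used once is at most \<open>|\<lambda> \<inter> \<mu>|\<close>, while counting positions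
  gives \<open>d \<ge> s + 2 (|\<mu>| - s)\<close>. So if the inequality fails, the restriction coefficients vanish for
  all large \<open>n\<close>, and so does their limit.
\<close>

section \<open>Leading words\<close>

definition fibre :: "nat \<Rightarrow> (nat \<Rightarrow> nat) \<Rightarrow> nat \<Rightarrow> nat set" where
  "fibre d u x = {p. p < d \<and> u p = x}"

text \<open>Potential to be maximised over the support. Here \<open>b\<close> is the row of a label, \<open>F\<close> its set of
  positions and \<open>K\<close> exceeds all position rows by more than one. The potential is rigged so that every
  term of the two Garnir relations used at a maximal word either has larger potential or equals the
  leading term up to row symmetries.\<close>

definition label_pot :: "nat \<Rightarrow> (nat \<Rightarrow> nat) \<Rightarrow> nat \<Rightarrow> nat set \<Rightarrow> nat" where
  "label_pot K rp b F =
     (if b = 0 then K * sum rp F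
      else if F = {} then 0
      else if card F = 1 then K * K * b + b * sum rp F
      else 2 * K * K * b + K * sum rp F)"

definition word_pot :: "nat \<Rightarrow> (nat \<Rightarrow> nat) \<Rightarrow> (nat \<Rightarrow> nat) \<Rightarrow> nat \<Rightarrow> nat \<Rightarrow> (nat \<Rightarrow> nat) \<Rightarrow> nat" where
  "word_pot K ra rp d n u = (\<Sum>x<n. label_pot K rp (ra x) (fibre d u x))"

lemma finite_fibre [simp]: "finite (fibre d u x)"
  by (simp add: fibre_def)

text \<open>Exchanging two labels or two positions alters the fibres of only two labels, so
  comparing potentials reduces to the two summands that change.\<close>

lemma sum_less_two:
  fixes f g :: "'a \<Rightarrow> nat"
  assumes "finite A" "x \<in> A" "y \<in> A" "x \<noteq> y"
    and "\<And>z. z \<in> A \<Longrightarrow> z \<noteq> x \<Longrightarrow> z \<noteq> y \<Longrightarrow> f z = g z"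
    and "f x + f y < g x + g y"
  shows "sum f A < sum g A"
proof -
  have split: "sum h A = h x + h y + sum h (A - {x} - {y})" for h :: "'a \<Rightarrow> nat"
    using assms(1-4) sum.remove[of A x h] sum.remove[of "A - {x}" y h] by auto
  have "sum f (A - {x} - {y}) = sum g (A - {x} - {y})"
    using assms(5) by (intro sum.cong) auto
  thus ?thesis using split[of f] split[of g] assms(6) by linarith
qed

text \<open>The sum is \<open>k * c\<close> for a natural number \<open>k\<close>, and
  \<open>k + 1\<close> is nonzero in characteristic zero. This is how a Garnir relation at a leading
  word forces the leading coefficient to vanish.\<close>

lemma sum_cancel:
  fixes c :: complex
  assumes "finite A" "\<And>x. x \<in> A \<Longrightarrow> g x = c \<or> g x = 0" "c + sum g A = 0"
  shows "c = 0"
proof -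
  have "\<exists>k::nat. sum g A = of_nat k * c"
    using assms(1,2)
  proof (induction A rule: finite_induct)
    case empty
    show ?case by (rule exI[of _ 0]) simp
  next
    case (insert x F)
    then obtain k :: nat where k: "sum g F = of_nat k * c" by auto
    have "g x = c \<or> g x = 0" using insert.prems by simp
    thus ?case
    proof
      assume "g x = c"
      thus ?thesis using insert.hyps k by (intro exI[of _ "Suc k"]) (simp add: algebra_simps)
    next
      assume "g x = 0"
      thus ?thesis using insert.hyps k by (intro exI[of _ k]) simp
    qed
  qed
  then obtain k :: nat where "sum g A = of_nat k * c" by auto
  hence "of_nat (Suc k) * c = 0" using assms(3) by (simp add: algebra_simps)
  thus ?thesis using of_nat_neq_0 by (metis mult_eq_0_iff)
qed

section \<open>Exchanges that raise the potential\<close>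

lemma label_pot_unused:
  assumes "0 < b" "F \<noteq> {}" "finite F" "\<And>p. p \<in> F \<Longrightarrow> rp p < K"
  shows "label_pot K rp 0 F + label_pot K rp b {} < label_pot K rp 0 {} + label_pot K rp b F"
proof (cases "card F = 1")
  case True
  then obtain p where p: "F = {p}" by (auto simp: card_1_singleton_iff)
  hence "rp p < K" using assms by auto
  \<comment> \<open>Below the first row of labels a single position earns at least
    \<open>K * K\<close>; in the first row it earns only \<open>K * rp p\<close>.\<close>
  hence "K * rp p < K * K" by auto
  also have "\<dots> \<le> K * K * b" using assms(1) by simp
  finally have "K * rp p < K * K * b + b * rp p" by (rule trans_less_add1)
  thus ?thesis using p assms(1) by (simp add: label_pot_def del: mult_less_cancel1)
next
  case False
  obtain p where "p \<in> F" using assms by auto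
  hence "0 < K" using assms(4) by force
  thus ?thesis using False assms by (simp add: label_pot_def)
qed

text \<open>Handing the larger fibre to the lower row of labels gains \<open>K * K * (b - a)\<close>
  from the leading terms, which outweighs the loss \<open>(b - a) * rp p\<close> from the single
  position.\<close>

lemma label_pot_big:
  assumes "0 < a" "a < b" "F \<noteq> {}" "card F \<noteq> 1" "rp p < K"
  shows "label_pot K rp a F + label_pot K rp b {p} < label_pot K rp a {p} + label_pot K rp b F"
proof -
  obtain c where c: "b = a + c" "0 < c" using assms(2) by (metis less_imp_add_positive)
  have "rp p < K * K" using assms(5) by (metis le_square order_less_le_trans)
  hence "c * rp p < c * (K * K)" using c by simp
  thus ?thesis using assms c by (simp add: label_pot_def algebra_simps)
qed

text \<open>Rearrangement inequality: the products \<open>b * rp p\<close> have the larger total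
  when the lower label gets the lower position.\<close>

lemma label_pot_single:
  assumes "0 < a" "a < b" "rp p < rp p'"
  shows "label_pot K rp a {p'} + label_pot K rp b {p} < label_pot K rp a {p} + label_pot K rp b {p'}"
proof -
  obtain c where c: "b = a + c" "0 < c" using assms(2) by (metis less_imp_add_positive)
  have "c * rp p < c * rp p'" using c assms by simp
  thus ?thesis using assms c by (simp add: label_pot_def algebra_simps)
qed

text \<open>With \<open>c = rp q - rp p\<close>, the label holding \<open>F\<close> gains
  \<open>K * c\<close>, while the label used once loses \<open>Suc (rp p) * c\<close>, its weight
  being its row.\<close>

lemma label_pot_move:
  assumes "b = 0 \<or> card F \<noteq> 1" "p \<in> F" "q \<notin> F" "finite F"
    and "rp p < rp q" "Suc (rp p) < K"
  shows "label_pot K rp b F + label_pot K rp (Suc (rp p)) {q}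
       < label_pot K rp b (insert q (F - {p})) + label_pot K rp (Suc (rp p)) {p}"
proof -
  obtain c where c: "rp q = rp p + c" "0 < c" using assms(5) by (metis less_imp_add_positive)
  have "sum rp (insert q (F - {p})) = rp q + sum rp (F - {p})"
    using assms by (subst sum.insert) auto
  also have "\<dots> = sum rp F + c" using assms c sum.remove[of F p rp] by simp
  finally have s: "sum rp (insert q (F - {p})) = sum rp F + c" .
  have cd: "card (insert q (F - {p})) = card F" "F \<noteq> {}"
    using assms card_Suc_Diff1[of F p] by (auto simp: card_insert_if)
  have "Suc (rp p) * c < K * c" using assms(6) c(2) by (rule mult_less_mono1)
  moreover have "label_pot K rp b (insert q (F - {p})) = label_pot K rp b F + K * c"
    using assms(1) s cd by (auto simp: label_pot_def algebra_simps)
  moreover have "label_pot K rp (Suc (rp p)) {q} = label_pot K rp (Suc (rp p)) {p} + Suc (rp p) * c"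
    by (simp add: label_pot_def c(1) algebra_simps)
  ultimately show ?thesis by linarith
qed

lemma fibre_swap_labels:
  "fibre d (restrict (transpose x y \<circ> u) {..<d}) z = fibre d u (transpose x y z)"
  by (auto simp: fibre_def dest: sym)

lemma word_pot_swap_labels:
  assumes "x < n" "y < n" "x \<noteq> y"
    and "label_pot K rp (ra x) (fibre d u x) + label_pot K rp (ra y) (fibre d u y)
       < label_pot K rp (ra x) (fibre d u y) + label_pot K rp (ra y) (fibre d u x)"
  shows "word_pot K ra rp d n u < word_pot K ra rp d n (restrict (transpose x y \<circ> u) {..<d})"
  unfolding word_pot_def
  by (rule sum_less_two[of _ x y]) (use assms in \<open>auto simp: fibre_swap_labels transpose_def\<close>)

lemma fibre_swap_positions:
  assumes "p < d" "q < d" "u p \<noteq> u q"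
  shows "fibre d (u \<circ> transpose p q) (u p) = insert q (fibre d u (u p) - {p})"
    and "fibre d (u \<circ> transpose p q) (u q) = insert p (fibre d u (u q) - {q})"
    and "z \<noteq> u p \<Longrightarrow> z \<noteq> u q \<Longrightarrow> fibre d (u \<circ> transpose p q) z = fibre d u z"
  using assms by (auto simp: fibre_def transpose_def split: if_splits)

lemma word_pot_swap_positions:
  assumes "p < d" "q < d" "u p \<noteq> u q" "u p < n" "u q < n"
    and "label_pot K rp (ra (u p)) (fibre d u (u p)) + label_pot K rp (ra (u q)) (fibre d u (u q))
       < label_pot K rp (ra (u p)) (insert q (fibre d u (u p) - {p}))
         + label_pot K rp (ra (u q)) (insert p (fibre d u (u q) - {q}))"
  shows "word_pot K ra rp d n u < word_pot K ra rp d n (u \<circ> transpose p q)"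
  unfolding word_pot_def
  by (rule sum_less_two[of _ "u p" "u q"]) (use assms in \<open>auto simp: fibre_swap_positions\<close>)

lemma words_swap_labels:
  "u \<in> words d n \<Longrightarrow> x < n \<Longrightarrow> y < n \<Longrightarrow> restrict (transpose x y \<circ> u) {..<d} \<in> words d n"
  by (auto simp: words_def PiE_iff transpose_def extensional_def)

lemma words_comp_perm:
  assumes "u \<in> words d n" "g permutes {..<d}"
  shows "u \<circ> g \<in> words d n"
proof -
  have "g p < d \<longleftrightarrow> p < d" for p using permutes_in_image[OF assms(2), of p] by simp
  thus ?thesis using assms(1) by (auto simp: words_def PiE_iff extensional_def)
qed

lemma words_swap_positions:
  "u \<in> words d n \<Longrightarrow> p < d \<Longrightarrow> q < d \<Longrightarrow> u \<circ> transpose p q \<in> words d n"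
  by (rule words_comp_perm) (auto intro: permutes_swap_id)

lemma fibre_eq_singletonD:
  assumes "fibre d u x = {p}"
  shows "p < d" "u p = x" "\<And>q. q < d \<Longrightarrow> u q = x \<Longrightarrow> q = p"
  using assms by (auto simp: fibre_def)

text \<open>A word of maximal potential in the support of \<open>w\<close> works. If a claim failed
  at it, some Garnir relation would have only further terms that vanish by maximality, equal
  \<open>w u\<close> by symmetry, or are excluded by induction; then a positive multiple of
  \<open>w u\<close> would be zero.\<close>

lemma extremal_word:
  fixes w :: "(nat \<Rightarrow> nat) \<Rightarrow> complex" and ra rp :: "nat \<Rightarrow> nat"
  assumes u0: "u0 \<in> words d n" "w u0 \<noteq> 0"
    and label_sym: "\<And>u x y. u \<in> words d n \<Longrightarrow> x < n \<Longrightarrow> y < n \<Longrightarrow> ra x = ra y \<Longrightarrow>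
          w (restrict (transpose x y \<circ> u) {..<d}) = w u"
    and label_garnir: "\<And>u y a. u \<in> words d n \<Longrightarrow> y < n \<Longrightarrow> a < ra y \<Longrightarrow>
          w u + (\<Sum>x | x < n \<and> ra x = a. w (restrict (transpose x y \<circ> u) {..<d})) = 0"
    and pos_sym: "\<And>u p q. u \<in> words d n \<Longrightarrow> p < d \<Longrightarrow> q < d \<Longrightarrow> rp p = rp q \<Longrightarrow>
          w (u \<circ> transpose p q) = w u"
    and pos_garnir: "\<And>u q i. u \<in> words d n \<Longrightarrow> q < d \<Longrightarrow> i < rp q \<Longrightarrow>
          w u + (\<Sum>p | p < d \<and> rp p = i. w (u \<circ> transpose p q)) = 0"
  obtains u where "u \<in> words d n"
    and "\<And>x. x < n \<Longrightarrow> 0 < ra x \<Longrightarrow> fibre d u x \<noteq> {}"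
    and "\<And>x p. x < n \<Longrightarrow> 0 < ra x \<Longrightarrow> fibre d u x = {p} \<Longrightarrow> ra x = Suc (rp p)"
proof -
  define K where "K = Suc (Suc (\<Sum>p<d. rp p))"
  have K: "Suc (rp p) < K" if "p < d" for p
    using that member_le_sum[of p "{..<d}" rp] by (simp add: K_def)
  hence K': "rp p < K" if "p < d" for p using that by (meson Suc_lessD)
  let ?P = "word_pot K ra rp d n"
  have fin: "finite {u \<in> words d n. w u \<noteq> 0}"
    by (simp add: words_def finite_PiE)
  obtain u where u: "u \<in> words d n" "w u \<noteq> 0"
    and max: "\<And>v. v \<in> words d n \<Longrightarrow> w v \<noteq> 0 \<Longrightarrow> ?P v \<le> ?P u"
  proof -
    have "finite (?P ` {u \<in> words d n. w u \<noteq> 0})" "?P ` {u \<in> words d n. w u \<noteq> 0} \<noteq> {}"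
      using fin u0 by auto
    from Max_in[OF this] Max_ge[OF this(1)] show ?thesis by (auto intro!: that)
  qed
  have vanish: "w v = 0" if "v \<in> words d n" "?P u < ?P v" for v
    using max[of v] that by (metis not_less)
  have un: "u p < n" if "p < d" for p using u(1) that by (auto simp: words_def PiE_iff)
  have used: "fibre d u y \<noteq> {}" if y: "y < n" "0 < ra y" for y
  proof
    assume empty: "fibre d u y = {}"
    have "w u = 0"
    proof (rule sum_cancel[OF _ _ label_garnir[OF u(1) y]])
      fix x assume x: "x \<in> {x. x < n \<and> ra x = 0}"
      let ?v = "restrict (transpose x y \<circ> u) {..<d}"
      have ne: "x \<noteq> y" using x y by auto
      show "w ?v = w u \<or> w ?v = 0"
      proof (cases "fibre d u x = {}")
        case True
        have "?v = u"
        proof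
          fix p
          show "?v p = u p"
          proof (cases "p < d")
            case p: True
            hence "u p \<noteq> x" "u p \<noteq> y" using empty True by (auto simp: fibre_def)
            thus ?thesis using p by simp
          next
            case False
            thus ?thesis using u(1) by (auto simp: words_def PiE_iff extensional_def)
          qed
        qed
        thus ?thesis by simp
      next
        case False
        have "?P u < ?P ?v"
        proof (rule word_pot_swap_labels)
          show "label_pot K rp (ra x) (fibre d u x) + label_pot K rp (ra y) (fibre d u y)
            < label_pot K rp (ra x) (fibre d u y) + label_pot K rp (ra y) (fibre d u x)"
            using label_pot_unused[OF y(2) False finite_fibre, of rp K] x empty K'
              fibre_def[of d u x] by auto
        qed (use x y ne in auto)
        thus ?thesis using vanish words_swap_labels[OF u(1), of x y] x y by auto
      qed
    qed simp
    thus False using u by simp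
  qed
  \<comment> \<open>Induction on the smaller of the two row indices: labels and positions in rows
    before \<open>r\<close> are then known to be on the diagonal, which excludes precisely the terms
    that the potential does not control.\<close>
  define bad where "bad r \<longleftrightarrow> (\<exists>x p. x < n \<and> 0 < ra x \<and> fibre d u x = {p} \<and>
    ra x \<noteq> Suc (rp p) \<and> r = min (ra x) (Suc (rp p)))" for r
  have nobad: "\<not> bad r" for r
  proof (induction r rule: less_induct)
    case (less r)
    have diag: "ra x = Suc (rp p)"
      if "x < n" "0 < ra x" "fibre d u x = {p}" "ra x < r \<or> Suc (rp p) < r" for x p
    proof (rule ccontr)
      assume "ra x \<noteq> Suc (rp p)"
      hence "bad (min (ra x) (Suc (rp p)))" using that unfolding bad_def by blast
      moreover have "min (ra x) (Suc (rp p)) < r" using that(4) by linarith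
      ultimately show False using less by blast
    qed
    show ?case
    proof
      assume "bad r"
      then obtain y q where y: "y < n" "0 < ra y" "fibre d u y = {q}" "ra y \<noteq> Suc (rp q)"
        and r: "r = min (ra y) (Suc (rp q))" by (auto simp: bad_def)
      note q = fibre_eq_singletonD[OF y(3)]
      show False
      proof (cases "Suc (rp q) < ra y")
        case True
        hence r': "r = Suc (rp q)" using r by simp
        \<comment> \<open>The label lies too low. The relation exchanges it with the labels of row
          \<open>Suc (rp q)\<close>, the row that would put \<open>q\<close> on the
          diagonal.\<close>
        have "w u = 0"
        proof (rule sum_cancel[OF _ _ label_garnir[OF u(1) y(1) True]])
          fix x assume x: "x \<in> {x. x < n \<and> ra x = Suc (rp q)}"
          let ?v = "restrict (transpose x y \<circ> u) {..<d}"
          have ne: "x \<noteq> y" using x y by auto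
          have v: "?v \<in> words d n" using words_swap_labels[OF u(1), of x y] x y by auto
          have nex: "fibre d u x \<noteq> {}" using used x by simp
          show "w ?v = w u \<or> w ?v = 0"
          proof (cases "card (fibre d u x) = 1")
            case False
            have "?P u < ?P ?v"
            proof (rule word_pot_swap_labels)
              show "label_pot K rp (ra x) (fibre d u x) + label_pot K rp (ra y) (fibre d u y)
                < label_pot K rp (ra x) (fibre d u y) + label_pot K rp (ra y) (fibre d u x)"
                using label_pot_big[of "ra x" "ra y" "fibre d u x" rp q K] nex False K'[OF q(1)] x y True
                by auto
            qed (use x y ne in auto)
            thus ?thesis using vanish v by auto
          next
            case card1: True
            then obtain p where p: "fibre d u x = {p}" by (auto simp: card_1_singleton_iff)
            note p' = fibre_eq_singletonD[OF p]
            consider "rp p < rp q" | "rp p = rp q" | "rp q < rp p" by linarith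
            thus ?thesis
            proof cases
              case 1
              \<comment> \<open>Impossible: \<open>x\<close> would be off the diagonal with smaller
                index \<open>Suc (rp p)\<close>.\<close>
              thus ?thesis using diag[of x p] x p r' by auto
            next
              case 2
              \<comment> \<open>Exchanging two labels used once amounts to exchanging their
                positions, which here lie in a common row.\<close>
              have "?v = u \<circ> transpose p q"
              proof
                fix s
                show "?v s = (u \<circ> transpose p q) s"
                proof (cases "s < d")
                  case s: True
                  show ?thesis
                  proof (cases "s = p \<or> s = q")
                    case True thus ?thesis using s p'(1,2) q(1,2) by auto
                  next
                    case False
                    hence "u s \<noteq> x" "u s \<noteq> y" using s p' q by blast+
                    thus ?thesis using s False by simp
                  qed
                next
                  case False
                  hence "s \<noteq> p" "s \<noteq> q" using p'(1) q(1) by auto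
                  thus ?thesis using False u(1) by (auto simp: words_def PiE_iff extensional_def)
                qed
              qed
              thus ?thesis using pos_sym[OF u(1) p'(1) q(1) 2] by simp
            next
              case 3
              have "?P u < ?P ?v"
              proof (rule word_pot_swap_labels)
                show "label_pot K rp (ra x) (fibre d u x) + label_pot K rp (ra y) (fibre d u y)
                  < label_pot K rp (ra x) (fibre d u y) + label_pot K rp (ra y) (fibre d u x)"
                  using label_pot_single[of "ra x" "ra y" rp q p K] 3 x y p True by auto
              qed (use x y ne in auto)
              thus ?thesis using vanish v by auto
            qed
          qed
        qed simp
        thus False using u by simp
      next
        case False
        hence lt: "ra y < Suc (rp q)" using y(4) by linarith
        hence r': "r = ra y" using r by simp
        \<comment> \<open>Now the position lies too low, and the position relation is used. The
          shift by one arises because row \<open>i\<close> of \<lambda> is matched with row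
          \<open>i + 1\<close> of \<nu>.\<close>
        define i where "i = ra y - 1"
        have i: "ra y = Suc i" "i < rp q" using y(2) lt by (auto simp: i_def)
        have "w u = 0"
        proof (rule sum_cancel[OF _ _ pos_garnir[OF u(1) q(1) i(2)]])
          fix p assume p: "p \<in> {p. p < d \<and> rp p = i}"
          let ?v = "u \<circ> transpose p q"
          have v: "?v \<in> words d n" using words_swap_positions[OF u(1)] p q(1) by auto
          have "p \<noteq> q" using p i(2) by auto
          hence ne: "p \<noteq> q" "u p \<noteq> u q" using q(2) q(3)[of p] p by auto
          show "w ?v = w u \<or> w ?v = 0"
          proof (cases "0 < ra (u p) \<and> card (fibre d u (u p)) = 1")
            case False
            \<comment> \<open>A label in the first row, or one used at least twice, weights position
              rows by \<open>K\<close>, so trading \<open>p\<close> for the lower position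
              \<open>q\<close> pays.\<close>
            have "?P u < ?P ?v"
            proof (rule word_pot_swap_positions)
              show "label_pot K rp (ra (u p)) (fibre d u (u p)) + label_pot K rp (ra (u q)) (fibre d u (u q))
                < label_pot K rp (ra (u p)) (insert q (fibre d u (u p) - {p}))
                + label_pot K rp (ra (u q)) (insert p (fibre d u (u q) - {q}))"
                using label_pot_move[of "ra (u p)" "fibre d u (u p)" p q rp K] False p q(1,2) i ne K y(3)
                by (auto simp: fibre_def)
            qed (use p q(1) ne un in auto)
            thus ?thesis using vanish v by auto
          next
            case True
            then obtain p0 where "fibre d u (u p) = {p0}" by (auto simp: card_1_singleton_iff)
            moreover have "p \<in> fibre d u (u p)" using p by (auto simp: fibre_def)
            ultimately have fp: "fibre d u (u p) = {p}" by auto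
            note p' = fibre_eq_singletonD[OF fp]
            consider "ra (u p) < ra y" | "ra (u p) = ra y" | "ra y < ra (u p)" by linarith
            thus ?thesis
            proof cases
              case 1
              thus ?thesis using diag[OF un _ fp] True p i r' by auto
            next
              case 2
              have "?v = restrict (transpose (u p) y \<circ> u) {..<d}" (is "_ = ?v'")
              proof
                fix s
                show "?v s = ?v' s"
                proof (cases "s < d")
                  case s: True
                  show ?thesis
                  proof (cases "s = p \<or> s = q")
                    case True thus ?thesis using s p'(1,2) q(1,2) by auto
                  next
                    case False
                    hence "u s \<noteq> u p" "u s \<noteq> y" using s p' q by blast+
                    thus ?thesis using s False by simp
                  qed
                next
                  case False
                  hence "s \<noteq> p" "s \<noteq> q" using p'(1) q(1) by auto
                  thus ?thesis using False u(1) by (auto simp: words_def PiE_iff extensional_def)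
                qed
              qed
              thus ?thesis using label_sym[OF u(1) un y(1) 2] p by simp
            next
              case 3
              have "?P u < ?P ?v"
              proof (rule word_pot_swap_positions)
                show "label_pot K rp (ra (u p)) (fibre d u (u p)) + label_pot K rp (ra (u q)) (fibre d u (u q))
                  < label_pot K rp (ra (u p)) (insert q (fibre d u (u p) - {p}))
                  + label_pot K rp (ra (u q)) (insert p (fibre d u (u q) - {q}))"
                  using label_pot_single[of "ra y" "ra (u p)" rp p q K] 3 p q(2) i y(2,3) fp by simp
              qed (use p q(1) ne un in auto)
              thus ?thesis using vanish v by auto
            qed
          qed
        qed simp
        thus False using u by simp
      qed
    qed
  qed
  show thesis
    by (rule that[OF u(1) used]) (use nobad[unfolded bad_def] in blast)+
qed

section \<open>Row and column groups and Garnir relations\<close>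

lemma set_cells: "set (cells l) = (SIGMA i:{..<length l}. {..<l ! i})"
  by (auto simp: cells_def)

lemma length_cells [simp]: "length (cells l) = sum_list l"
proof -
  have "map (\<lambda>i. length (map (\<lambda>j. (i, j)) [0..<l ! i])) [0..<length l] = l"
    by (simp add: map_nth)
  thus ?thesis by (simp add: cells_def length_concat o_def)
qed

lemma distinct_cells: "distinct (cells l)"
proof -
  have "card (set (cells l)) = (\<Sum>i<length l. l ! i)"
    by (simp add: set_cells)
  also have "\<dots> = length (cells l)"
    by (simp add: sum_list_sum_nth atLeast0LessThan)
  finally show ?thesis by (rule card_distinct)
qed

abbreviation cell_row :: "nat list \<Rightarrow> nat \<Rightarrow> nat" where
  "cell_row l k \<equiv> fst (cells l ! k)"

abbreviation cell_col :: "nat list \<Rightarrow> nat \<Rightarrow> nat" where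
  "cell_col l k \<equiv> snd (cells l ! k)"

lemma cell_bounds:
  assumes "k < sum_list l"
  shows "cell_row l k < length l" "cell_col l k < l ! cell_row l k"
proof -
  have "cells l ! k \<in> set (cells l)" using assms by simp
  thus "cell_row l k < length l" "cell_col l k < l ! cell_row l k"
    by (auto simp: set_cells mem_Sigma_iff split: prod.splits)
qed

lemma cell_exists:
  assumes "i < length l" "j < l ! i"
  obtains k where "k < sum_list l" "cells l ! k = (i, j)"
proof -
  have "(i, j) \<in> set (cells l)" using assms by (simp add: set_cells)
  thus ?thesis using that by (auto simp: in_set_conv_nth)
qed

lemma card_cell_row:
  assumes "i < length l"
  shows "card {k. k < sum_list l \<and> cell_row l k = i} = l ! i"
proof -
  have "bij_betw ((!) (cells l)) {k. k < sum_list l \<and> cell_row l k = i} ({i} \<times> {..<l ! i})"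
    unfolding bij_betw_def
  proof
    show "inj_on ((!) (cells l)) {k. k < sum_list l \<and> cell_row l k = i}"
      using distinct_cells[of l] by (auto simp: inj_on_def nth_eq_iff_index_eq)
    show "(!) (cells l) ` {k. k < sum_list l \<and> cell_row l k = i} = {i} \<times> {..<l ! i}"
    proof
      show "(!) (cells l) ` {k. k < sum_list l \<and> cell_row l k = i} \<subseteq> {i} \<times> {..<l ! i}"
      proof
        fix c assume "c \<in> (!) (cells l) ` {k. k < sum_list l \<and> cell_row l k = i}"
        then obtain k where "c = cells l ! k" "k < sum_list l" "cell_row l k = i" by blast
        thus "c \<in> {i} \<times> {..<l ! i}" using cell_bounds(2)[of k l] by (simp add: mem_Times_iff)
      qed
      show "{i} \<times> {..<l ! i} \<subseteq> (!) (cells l) ` {k. k < sum_list l \<and> cell_row l k = i}"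
      proof
        fix c assume "c \<in> {i} \<times> {..<l ! i}"
        then obtain j where j: "c = (i, j)" "j < l ! i" by auto
        then obtain k where "k < sum_list l" "cells l ! k = (i, j)"
          using cell_exists assms by blast
        thus "c \<in> (!) (cells l) ` {k. k < sum_list l \<and> cell_row l k = i}"
          using j by (intro image_eqI[of _ _ k]) auto
      qed
    qed
  qed
  from bij_betw_same_card[OF this] show ?thesis by simp
qed

text \<open>Common form of the row group and the column group, so that reindexing of group sums is
  proved once for both.\<close>

definition stab_perms :: "nat \<Rightarrow> (nat \<Rightarrow> nat) \<Rightarrow> (nat \<Rightarrow> nat) set" where
  "stab_perms n \<phi> = {p. p permutes {..<n} \<and> (\<forall>k<n. \<phi> (p k) = \<phi> k)}"

lemma row_group_eq: "row_group l = stab_perms (sum_list l) (cell_row l)"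
  and col_group_eq: "col_group l = stab_perms (sum_list l) (cell_col l)"
  by (auto simp: row_group_def col_group_def stab_perms_def perms_def)

lemma permutes_lessThan_iff: "p permutes {..<n} \<Longrightarrow> p k < n \<longleftrightarrow> k < (n::nat)"
  using permutes_in_image[of p "{..<n}" k] by simp

lemma stab_perms_permutes: "p \<in> stab_perms n \<phi> \<Longrightarrow> p permutes {..<n}"
  by (simp add: stab_perms_def)

lemma comp_in_stab_perms:
  "p \<in> stab_perms n \<phi> \<Longrightarrow> q \<in> stab_perms n \<phi> \<Longrightarrow> p \<circ> q \<in> stab_perms n \<phi>"
  by (auto simp: stab_perms_def permutes_compose permutes_lessThan_iff)

lemma inv_in_stab_perms:
  assumes "p \<in> stab_perms n \<phi>"
  shows "inv p \<in> stab_perms n \<phi>"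
proof -
  have p: "p permutes {..<n}" "\<And>k. k < n \<Longrightarrow> \<phi> (p k) = \<phi> k"
    using assms by (auto simp: stab_perms_def)
  have i: "inv p permutes {..<n}" by (rule permutes_inv[OF p(1)])
  have "\<phi> (inv p k) = \<phi> k" if "k < n" for k
    using p(2)[of "inv p k"] that permutes_lessThan_iff[OF i] permutes_inverses(1)[OF p(1)] by simp
  thus ?thesis using i by (simp add: stab_perms_def)
qed

lemma transpose_in_stab_perms:
  "x < n \<Longrightarrow> y < n \<Longrightarrow> \<phi> x = \<phi> y \<Longrightarrow> transpose x y \<in> stab_perms n \<phi>"
  by (auto simp: stab_perms_def transpose_def intro: permutes_swap_id)

lemma inv_comp_cancel:
  assumes "p permutes S"
  shows "inv p \<circ> (p \<circ> g) = g" "p \<circ> (inv p \<circ> g) = g" "(g \<circ> p) \<circ> inv p = g" "(g \<circ> inv p) \<circ> p = g"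
  using permutes_inv_o[OF assms] by (simp_all add: o_assoc[symmetric]) (simp_all add: o_assoc)

lemma sum_stab_perms_comp_left:
  assumes "s \<in> stab_perms n \<phi>"
  shows "(\<Sum>r\<in>stab_perms n \<phi>. f (s \<circ> r)) = sum f (stab_perms n \<phi>)"
  by (rule sum.reindex_bij_witness[of _ "\<lambda>r. inv s \<circ> r" "\<lambda>r. s \<circ> r"])
    (use assms inv_in_stab_perms[OF assms] in
      \<open>auto simp: inv_comp_cancel[OF stab_perms_permutes[OF assms]] intro: comp_in_stab_perms\<close>)

lemma sum_stab_perms_inv:
  "(\<Sum>r\<in>stab_perms n \<phi>. f (inv r)) = sum f (stab_perms n \<phi>)"
  by (rule sum.reindex_bij_witness[of _ inv inv])
    (auto simp: inv_in_stab_perms permutes_inv_inv[OF stab_perms_permutes])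

text \<open>The symmetrizer of row \<open>a\<close> enlarged by \<open>y\<close> annihilates the Young symmetrizer from the left: since
  row \<open>a\<close> is at least as long as the row of \<open>y\<close>, after any row permutation two of the symmetrized
  entries still come from a common column.\<close>

lemma garnir_relation:
  fixes l :: "nat list" and \<Phi> W :: "(nat \<Rightarrow> nat) \<Rightarrow> complex"
  assumes l: "sorted_wrt (\<ge>) l" and y: "y < sum_list l" and a: "a < cell_row l y"
    and alt: "\<And>g s t. g permutes {..<sum_list l} \<Longrightarrow> s < sum_list l \<Longrightarrow> t < sum_list l \<Longrightarrow> s \<noteq> t \<Longrightarrow>
        cell_col l s = cell_col l t \<Longrightarrow> \<Phi> (g \<circ> transpose s t) = - \<Phi> g"
    and W: "\<And>g. W g = (\<Sum>r\<in>row_group l. \<Phi> (g \<circ> r))"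
  shows "(\<Sum>x\<in>insert y {x. x < sum_list l \<and> cell_row l x = a}. W (transpose x y)) = 0"
proof -
  let ?n = "sum_list l"
  define A where "A = {x. x < ?n \<and> cell_row l x = a}"
  have yA: "y \<notin> A" and finA: "finite A" and sub: "insert y A \<subseteq> {..<?n}"
    using a y by (auto simp: A_def)
  \<comment> \<open>For each row permutation \<open>r\<close>, one transposition inside the enlarged
    row preserves the sum by reindexing and also reverses its sign.\<close>
  have inner: "(\<Sum>h | h permutes insert y A. \<Phi> (h \<circ> r)) = 0" if r: "r \<in> row_group l" for r
  proof -
    have rp: "r permutes {..<?n}" and rr: "\<And>k. k < ?n \<Longrightarrow> cell_row l (r k) = cell_row l k"
      using r by (auto simp: row_group_eq stab_perms_def)
    define y' where "y' = inv r y"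
    have ry: "r y' = y" by (simp add: y'_def permutes_inverses(1)[OF rp])
    have y': "y' < ?n" using permutes_lessThan_iff[OF permutes_inv[OF rp]] y by (simp add: y'_def)
    have row: "cell_row l y' = cell_row l y" using rr[OF y'] ry by simp
    have "l ! cell_row l y' \<le> l ! a"
      using l a row cell_bounds[OF y'] by (simp add: sorted_wrt_iff_nth_less)
    then obtain z' where z': "z' < ?n" "cells l ! z' = (a, cell_col l y')"
      using cell_exists[of a l "cell_col l y'"] cell_bounds[OF y'] a row
      by (metis order_less_le_trans order_less_trans)
    define z where "z = r z'"
    have z: "z \<in> A" using z' rr[of z'] permutes_lessThan_iff[OF rp] by (simp add: z_def A_def)
    have ne: "y' \<noteq> z'"
    proof
      assume "y' = z'"
      hence "cell_row l y' = a" using arg_cong[OF z'(2), of fst] by (simp only: fst_conv)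
      thus False using a row by simp
    qed
    \<comment> \<open>Moved past \<open>r\<close>, the transposition of two symmetrized entries
      becomes a transposition inside one column.\<close>
    have tr: "transpose y z \<circ> r = r \<circ> transpose y' z'"
      using permutes_inj[OF rp] ry unfolding z_def
      by (auto simp: fun_eq_iff transpose_def inj_eq)
    have perm: "transpose y z permutes insert y A" using z by (intro permutes_swap_id) auto
    have "(\<Sum>h | h permutes insert y A. \<Phi> (h \<circ> r))
        = (\<Sum>h | h permutes insert y A. \<Phi> ((h \<circ> transpose y z) \<circ> r))"
      by (rule sum_permutations_compose_right[OF perm])
    also have "\<dots> = (\<Sum>h | h permutes insert y A. - \<Phi> (h \<circ> r))"
    proof (rule sum.cong[OF refl])
      fix h assume "h \<in> {h. h permutes insert y A}"
      hence "h \<circ> r permutes {..<?n}"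
        using rp permutes_subset[OF _ sub] by (auto intro: permutes_compose)
      from alt[OF this y' z'(1) ne] z'(2)
      show "\<Phi> ((h \<circ> transpose y z) \<circ> r) = - \<Phi> (h \<circ> r)" by (simp add: o_assoc[symmetric] tr)
    qed
    finally show ?thesis by (simp add: sum_negf)
  qed
  have Winv: "W (g \<circ> q) = W g" if "q permutes A" for g q
  proof -
    have q: "q \<in> row_group l"
    proof -
      have "q permutes {..<?n}" by (rule permutes_subset[OF that]) (auto simp: A_def)
      moreover have "cell_row l (q k) = cell_row l k" for k
        using permutes_in_image[OF that, of k] permutes_not_in[OF that, of k]
        by (cases "k \<in> A") (auto simp: A_def)
      ultimately show ?thesis by (simp add: row_group_eq stab_perms_def)
    qed
    have "W (g \<circ> q) = (\<Sum>r\<in>row_group l. \<Phi> (g \<circ> (q \<circ> r)))" by (simp add: W o_assoc)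
    also have "\<dots> = W g"
      using q sum_stab_perms_comp_left[of q ?n "cell_row l" "\<lambda>r. \<Phi> (g \<circ> r)"]
      by (simp add: W row_group_eq)
    finally show ?thesis .
  qed
  \<comment> \<open>Splitting the permutations of \<open>insert y A\<close> into cosets of those of
    \<open>A\<close>, under which \<open>W\<close> is invariant, leaves the required sum times the
    number of permutations of \<open>A\<close>.\<close>
  have "0 = (\<Sum>r\<in>row_group l. \<Sum>h | h permutes insert y A. \<Phi> (h \<circ> r))"
    by (simp add: inner)
  also have "\<dots> = (\<Sum>h | h permutes insert y A. W h)"
    by (subst sum.swap) (simp add: W)
  also have "\<dots> = (\<Sum>x\<in>insert y A. \<Sum>q | q permutes A. W (transpose y x \<circ> q))"
    by (rule sum_over_permutations_insert[OF finA yA])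
  also have "\<dots> = of_nat (card {q. q permutes A}) * (\<Sum>x\<in>insert y A. W (transpose x y))"
    by (simp add: Winv sum_distrib_left transpose_commute[of y])
  finally have "of_nat (card {q. q permutes A}) * (\<Sum>x\<in>insert y A. W (transpose x y)) = 0" by simp
  moreover have "card {q. q permutes A} \<noteq> 0"
    by (simp add: card_permutations[OF refl finA])
  ultimately show ?thesis by (simp add: A_def)
qed

section \<open>Left symmetries of the Young symmetrizer\<close>

lemma sum_col_group_transpose:
  fixes f :: "(nat \<Rightarrow> nat) \<Rightarrow> complex"
  assumes "s < sum_list l" "t < sum_list l" "s \<noteq> t" "cell_col l s = cell_col l t"
  shows "(\<Sum>q\<in>col_group l. of_int (sign q) * f (transpose s t \<circ> q))
       = - (\<Sum>q\<in>col_group l. of_int (sign q) * f q)"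
proof -
  have tr: "transpose s t \<in> col_group l"
    using assms by (simp add: col_group_eq transpose_in_stab_perms)
  have "(\<Sum>q\<in>col_group l. of_int (sign q) * f (transpose s t \<circ> q))
      = (\<Sum>q\<in>col_group l. of_int (sign (transpose s t \<circ> q)) * f (transpose s t \<circ> (transpose s t \<circ> q)))"
    using sum_stab_perms_comp_left[of "transpose s t" "sum_list l" "cell_col l"
        "\<lambda>q. of_int (sign q) * f (transpose s t \<circ> q)"] tr by (simp add: col_group_eq)
  also have "\<dots> = (\<Sum>q\<in>col_group l. - (of_int (sign q) * f q))"
  proof (rule sum.cong[OF refl])
    fix q assume "q \<in> col_group l"
    hence "permutation q"
      by (auto simp: col_group_eq stab_perms_def intro: permutation_permutes[THEN iffD2])
    hence "sign (transpose s t \<circ> q) = - sign q"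
      using assms(3) by (simp add: sign_compose permutation_swap_id sign_swap_id)
    moreover have "transpose s t \<circ> (transpose s t \<circ> q) = q" by (simp add: o_assoc)
    ultimately show "of_int (sign (transpose s t \<circ> q)) * f (transpose s t \<circ> (transpose s t \<circ> q))
        = - (of_int (sign q) * f q)" by simp
  qed
  finally show ?thesis by (simp add: sum_negf)
qed

text \<open>This is the coefficient at \<open>\<pi>\<close> of \<sigma> times the Young symmetrizer,
  written as a row sum of a function of \<open>\<sigma> \<circ> r\<close>, the shape required of
  \<open>W\<close> in \<open>garnir_relation\<close>.\<close>

lemma young_sym_inv_comp:
  assumes "\<sigma> permutes {..<sum_list l}"
  shows "young_sym l (inv \<sigma> \<circ> \<pi>)
    = (\<Sum>r\<in>row_group l. \<Sum>q\<in>col_group l. of_int (sign q) * (if (\<sigma> \<circ> r) \<circ> q = \<pi> then 1 else 0))"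
proof -
  have "r \<circ> q = inv \<sigma> \<circ> \<pi> \<longleftrightarrow> (\<sigma> \<circ> r) \<circ> q = \<pi>" for r q
    using inv_comp_cancel[OF assms] by (metis o_assoc)
  thus ?thesis unfolding young_sym_def by (intro sum.cong refl) auto
qed

text \<open>The row symmetrizer is the left factor, and left translation by \<open>s\<close>
  permutes its terms.\<close>

lemma act_alg_row_group:
  assumes "s \<in> row_group l"
  shows "act_alg s (young_sym l) = young_sym l"
proof
  fix \<pi> :: "nat \<Rightarrow> nat"
  let ?f = "\<lambda>g. \<Sum>q\<in>col_group l. of_int (sign q) * (if g \<circ> q = \<pi> then 1 else (0::complex))"
  have s: "s permutes {..<sum_list l}" using assms by (simp add: row_group_eq stab_perms_def)
  have "act_alg s (young_sym l) \<pi> = (\<Sum>r\<in>row_group l. ?f (s \<circ> r))"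
    unfolding act_alg_def by (rule young_sym_inv_comp[OF s])
  also have "\<dots> = (\<Sum>r\<in>row_group l. ?f r)"
    using sum_stab_perms_comp_left[of s "sum_list l" "cell_row l" ?f] assms by (simp add: row_group_eq)
  also have "\<dots> = young_sym l \<pi>"
    using young_sym_inv_comp[OF permutes_id, of l \<pi>] by simp
  finally show "act_alg s (young_sym l) \<pi> = young_sym l \<pi>" .
qed

lemma act_alg_garnir:
  assumes "sorted_wrt (\<ge>) l" "y < sum_list l" "a < cell_row l y"
  shows "(\<Sum>x\<in>insert y {x. x < sum_list l \<and> cell_row l x = a}.
            act_alg (transpose x y) (young_sym l) \<pi>) = 0"
proof -
  \<comment> \<open>\<open>?f g\<close> is the coefficient at \<open>\<pi>\<close> of
    \<open>g\<close> times the column antisymmetrizer; it serves as the alternating function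
    \<open>\<Phi>\<close>.\<close>
  let ?f = "\<lambda>g. \<Sum>q\<in>col_group l. of_int (sign q) * (if g \<circ> q = \<pi> then 1 else (0::complex))"
  have "(\<Sum>x\<in>insert y {x. x < sum_list l \<and> cell_row l x = a}.
            (\<lambda>g. \<Sum>r\<in>row_group l. ?f (g \<circ> r)) (transpose x y)) = 0"
  proof (rule garnir_relation[OF assms])
    fix g s t assume st: "s < sum_list l" "t < sum_list l" "s \<noteq> t" "cell_col l s = cell_col l t"
    show "?f (g \<circ> transpose s t) = - ?f g"
      using sum_col_group_transpose[OF st, of "\<lambda>q. if g \<circ> q = \<pi> then 1 else 0"]
      by (simp add: o_assoc)
  qed simp
  moreover have "(\<Sum>x\<in>insert y {x. x < sum_list l \<and> cell_row l x = a}.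
            act_alg (transpose x y) (young_sym l) \<pi>)
      = (\<Sum>x\<in>insert y {x. x < sum_list l \<and> cell_row l x = a}.
            \<Sum>r\<in>row_group l. ?f (transpose x y \<circ> r))"
  proof (rule sum.cong[OF refl])
    fix x assume "x \<in> insert y {x. x < sum_list l \<and> cell_row l x = a}"
    hence "x < sum_list l" using assms(2) by auto
    thus "act_alg (transpose x y) (young_sym l) \<pi> = (\<Sum>r\<in>row_group l. ?f (transpose x y \<circ> r))"
      unfolding act_alg_def using young_sym_inv_comp[OF permutes_swap_id, of x l y \<pi>] assms(2)
      by simp
  qed
  ultimately show ?thesis by simp
qed

section \<open>Schur functors and homomorphisms from Specht modules\<close>

lemma word_restrict:
  "u \<in> words d n \<Longrightarrow> restrict u {..<d} = u"
  by (simp add: words_def PiE_restrict)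

lemma finite_words [simp]: "finite (words d n)"
  by (simp add: words_def finite_PiE)

lemma sum_words_comp_perm:
  assumes "g permutes {..<d}"
  shows "(\<Sum>u\<in>words d n. f (u \<circ> g)) = sum f (words d n)"
  by (rule sum.reindex_bij_witness[of _ "\<lambda>u. u \<circ> inv g" "\<lambda>u. u \<circ> g"])
    (auto simp: inv_comp_cancel[OF assms] intro: words_comp_perm assms permutes_inv)

text \<open>Inverting \<open>r \<circ> q\<close> brings the column permutation next to the word. The
  remaining inverses disappear by reindexing, since both groups are closed under inversion and
  inversion preserves signs.\<close>

lemma schurE:
  assumes "v \<in> schur l n"
  obtains t where "\<And>u. u \<in> words (sum_list l) n \<Longrightarrow>
      v u = (\<Sum>q\<in>col_group l. of_int (sign q) * (\<Sum>r\<in>row_group l. t (u \<circ> q \<circ> r)))"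
    and "\<And>u. u \<notin> words (sum_list l) n \<Longrightarrow> v u = 0"
proof -
  let ?d = "sum_list l"
  obtain t where t: "v = (\<lambda>u. if u \<in> words ?d n
      then (\<Sum>\<tau>\<in>perms ?d. young_sym l \<tau> * t (restrict (u \<circ> inv \<tau>) {..<?d})) else 0)"
    using assms by (auto simp: schur_def)
  have "v u = (\<Sum>q\<in>col_group l. of_int (sign q) * (\<Sum>r\<in>row_group l. t (u \<circ> q \<circ> r)))"
    if u: "u \<in> words ?d n" for u
  proof -
    have fin: "finite (perms ?d)" by (simp add: perms_def finite_permutations)
    have "v u = (\<Sum>\<tau>\<in>perms ?d. young_sym l \<tau> * t (u \<circ> inv \<tau>))"
    proof -
      have "restrict (u \<circ> inv \<tau>) {..<?d} = u \<circ> inv \<tau>" if "\<tau> \<in> perms ?d" for \<tau>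
        using word_restrict[OF words_comp_perm[OF u permutes_inv]] that by (simp add: perms_def)
      thus ?thesis using u t by (auto intro!: sum.cong)
    qed
    also have "\<dots> = (\<Sum>\<tau>\<in>perms ?d. \<Sum>r\<in>row_group l. \<Sum>q\<in>col_group l.
        if r \<circ> q = \<tau> then of_int (sign q) * t (u \<circ> inv \<tau>) else 0)"
      unfolding young_sym_def by (simp add: sum_distrib_right if_distrib[of "\<lambda>x. x * _"] cong: if_cong)
    also have "\<dots> = (\<Sum>r\<in>row_group l. \<Sum>\<tau>\<in>perms ?d. \<Sum>q\<in>col_group l.
        if r \<circ> q = \<tau> then of_int (sign q) * t (u \<circ> inv \<tau>) else 0)"
      by (rule sum.swap)
    also have "\<dots> = (\<Sum>r\<in>row_group l. \<Sum>q\<in>col_group l. \<Sum>\<tau>\<in>perms ?d.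
        if r \<circ> q = \<tau> then of_int (sign q) * t (u \<circ> inv \<tau>) else 0)"
      by (intro sum.cong refl sum.swap)
    also have "\<dots> = (\<Sum>r\<in>row_group l. \<Sum>q\<in>col_group l. of_int (sign (inv q)) * t (u \<circ> inv q \<circ> inv r))"
    proof (intro sum.cong refl)
      fix r q assume "r \<in> row_group l" "q \<in> col_group l"
      hence rq: "r permutes {..<?d}" "q permutes {..<?d}"
        by (auto simp: row_group_eq col_group_eq stab_perms_def)
      hence "r \<circ> q \<in> perms ?d" by (simp add: perms_def permutes_compose)
      moreover have "inv (r \<circ> q) = inv q \<circ> inv r"
        using rq by (simp add: o_inv_distrib permutes_bij)
      moreover have "sign (inv q) = sign q"
        using rq(2) by (intro sign_inverse) (auto simp: permutation_permutes)
      ultimately show "(\<Sum>\<tau>\<in>perms ?d. if r \<circ> q = \<tau> then of_int (sign q) * t (u \<circ> inv \<tau>) else 0)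
          = of_int (sign (inv q)) * t (u \<circ> inv q \<circ> inv r)"
        using fin by (simp add: o_assoc)
    qed
    also have "\<dots> = (\<Sum>r\<in>row_group l. \<Sum>q\<in>col_group l. of_int (sign q) * t (u \<circ> q \<circ> inv r))"
      unfolding col_group_eq
      by (intro sum.cong refl sum_stab_perms_inv[where f = "\<lambda>q. of_int (sign q) * t (u \<circ> q \<circ> _)"])
    also have "\<dots> = (\<Sum>r\<in>row_group l. \<Sum>q\<in>col_group l. of_int (sign q) * t (u \<circ> q \<circ> r))"
      unfolding row_group_eq
      by (rule sum_stab_perms_inv[where f = "\<lambda>r. \<Sum>q\<in>col_group l. of_int (sign q) * t (u \<circ> q \<circ> r)"])
    also have "\<dots> = (\<Sum>q\<in>col_group l. of_int (sign q) * (\<Sum>r\<in>row_group l. t (u \<circ> q \<circ> r)))"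
      by (subst sum.swap) (simp add: sum_distrib_left)
    finally show ?thesis .
  qed
  moreover have "v u = 0" if "u \<notin> words ?d n" for u using that t by simp
  ultimately show ?thesis by (rule that)
qed

text \<open>Column permutations stand next to the word in \<open>schurE\<close>, so \<open>s\<close>
  is absorbed by reindexing at the cost of its sign.\<close>

lemma schur_col_group:
  assumes "v \<in> schur l n" "u \<in> words (sum_list l) n" "s \<in> col_group l"
  shows "v (u \<circ> s) = of_int (sign s) * v u"
proof -
  obtain z where z: "\<And>u. u \<in> words (sum_list l) n \<Longrightarrow>
      v u = (\<Sum>q\<in>col_group l. of_int (sign q) * (\<Sum>r\<in>row_group l. z (u \<circ> q \<circ> r)))"
    by (rule schurE[OF assms(1)]) (rule that)
  let ?f = "\<lambda>q. \<Sum>r\<in>row_group l. z (u \<circ> q \<circ> r)"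
  have s: "s permutes {..<sum_list l}" using assms(3) by (simp add: col_group_eq stab_perms_def)
  have sgn: "sign q = sign s * sign (s \<circ> q)" if "q \<in> col_group l" for q
  proof -
    have "permutation s" "permutation q"
      using s that by (auto simp: permutation_permutes col_group_eq stab_perms_def)
    thus ?thesis by (simp add: sign_compose sign_idempotent flip: mult.assoc)
  qed
  have "v (u \<circ> s) = (\<Sum>q\<in>col_group l. of_int (sign q) * ?f (s \<circ> q))"
    using z[OF words_comp_perm[OF assms(2) s]] by (simp add: o_assoc)
  also have "\<dots> = (\<Sum>q\<in>col_group l. of_int (sign s) * (of_int (sign (s \<circ> q)) * ?f (s \<circ> q)))"
    by (intro sum.cong refl) (simp add: sgn)
  also have "\<dots> = of_int (sign s) * (\<Sum>q\<in>col_group l. of_int (sign (s \<circ> q)) * ?f (s \<circ> q))"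
    by (simp add: sum_distrib_left)
  also have "(\<Sum>q\<in>col_group l. of_int (sign (s \<circ> q)) * ?f (s \<circ> q)) = v u"
    using sum_stab_perms_comp_left[of s "sum_list l" "cell_col l" "\<lambda>q. of_int (sign q) * ?f q"]
      assms(3) z[OF assms(2)] by (simp add: col_group_eq)
  finally show ?thesis .
qed

lemma schur_alternating:
  assumes "v \<in> schur l n" "u \<in> words (sum_list l) n"
    and "s < sum_list l" "t < sum_list l" "s \<noteq> t" "cell_col l s = cell_col l t"
  shows "v (u \<circ> transpose s t) = - v u"
  using schur_col_group[OF assms(1,2), of "transpose s t"] assms(3-6)
  by (simp add: col_group_eq transpose_in_stab_perms sign_swap_id)

text \<open>With \<open>v = t a b\<close> for the row symmetrizer \<open>a\<close> and the column antisymmetrizer \<open>b\<close>, both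
  self-adjoint, \<open>\<langle>v, v\<rangle> = \<langle>v b, t a\<rangle> = |C| \<langle>v a, t\<rangle>\<close>, so \<open>v a = 0\<close> would force \<open>v = 0\<close>.\<close>

lemma schur_row_sum_nonzero:
  assumes v: "v \<in> schur l n" "v \<noteq> 0"
  shows "\<exists>u\<in>words (sum_list l) n. (\<Sum>r\<in>row_group l. v (u \<circ> r)) \<noteq> 0"
proof (rule ccontr)
  assume "\<not> ?thesis"
  hence zero: "(\<Sum>r\<in>row_group l. v (u \<circ> r)) = 0" if "u \<in> words (sum_list l) n" for u
    using that by blast
  let ?X = "words (sum_list l) n"
  obtain t where t: "\<And>u. u \<in> ?X \<Longrightarrow>
      v u = (\<Sum>q\<in>col_group l. of_int (sign q) * (\<Sum>r\<in>row_group l. t (u \<circ> q \<circ> r)))"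
    and off: "\<And>u. u \<notin> ?X \<Longrightarrow> v u = 0"
    by (rule schurE[OF v(1)]) (rule that)
  define c where "c u = (\<Sum>r\<in>row_group l. t (u \<circ> r))" for u
  have colp: "q permutes {..<sum_list l}" if "q \<in> col_group l" for q
    using that by (simp add: col_group_eq stab_perms_def)
  have rowp: "r permutes {..<sum_list l}" if "r \<in> row_group l" for r
    using that by (simp add: row_group_eq stab_perms_def)
  have "(\<Sum>u\<in>?X. v u * cnj (v u)) = (\<Sum>u\<in>?X. \<Sum>q\<in>col_group l. c (u \<circ> q) * cnj (v (u \<circ> q)))"
  proof (rule sum.cong[OF refl])
    fix u assume u: "u \<in> ?X"
    have "v u * cnj (v u) = (\<Sum>q\<in>col_group l. (of_int (sign q) * c (u \<circ> q)) * cnj (v u))"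
      using t[OF u] by (simp add: c_def sum_distrib_right)
    thus "v u * cnj (v u) = (\<Sum>q\<in>col_group l. c (u \<circ> q) * cnj (v (u \<circ> q)))"
      using schur_col_group[OF v(1) u] by (simp add: mult_ac)
  qed
  \<comment> \<open>After the change of variable from \<open>u \<circ> q\<close> to
    \<open>u\<close>, all column permutations contribute the same amount.\<close>
  also have "\<dots> = (\<Sum>q\<in>col_group l. \<Sum>u\<in>?X. c u * cnj (v u))"
    by (subst sum.swap, rule sum.cong[OF refl])
      (rule sum_words_comp_perm[OF colp, where f = "\<lambda>u. c u * cnj (v u)"])
  also have "(\<Sum>u\<in>?X. c u * cnj (v u)) = (\<Sum>r\<in>row_group l. \<Sum>u\<in>?X. t (u \<circ> r) * cnj (v u))"
    by (subst sum.swap) (simp add: c_def sum_distrib_right)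
  also have "\<dots> = (\<Sum>r\<in>row_group l. \<Sum>u\<in>?X. t u * cnj (v (u \<circ> inv r)))"
  proof (rule sum.cong[OF refl])
    fix r assume "r \<in> row_group l"
    note r = rowp[OF this]
    show "(\<Sum>u\<in>?X. t (u \<circ> r) * cnj (v u)) = (\<Sum>u\<in>?X. t u * cnj (v (u \<circ> inv r)))"
      using sum_words_comp_perm[OF r, where f = "\<lambda>u. t u * cnj (v (u \<circ> inv r))"]
      by (simp add: inv_comp_cancel[OF r])
  qed
  also have "\<dots> = (\<Sum>u\<in>?X. t u * cnj (\<Sum>r\<in>row_group l. v (u \<circ> inv r)))"
    by (subst sum.swap) (simp add: sum_distrib_left)
  also have "\<dots> = 0"
  proof (rule sum.neutral, rule ballI)
    fix u assume "u \<in> ?X"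
    hence "(\<Sum>r\<in>row_group l. v (u \<circ> inv r)) = 0"
      using zero sum_stab_perms_inv[where f = "\<lambda>r. v (u \<circ> r)"] by (simp add: row_group_eq)
    thus "t u * cnj (\<Sum>r\<in>row_group l. v (u \<circ> inv r)) = 0" by simp
  qed
  finally have "(\<Sum>u\<in>?X. v u * cnj (v u)) = 0" by simp
  \<comment> \<open>Positive definiteness: the sum of squared norms is zero, so every coordinate
    is.\<close>
  moreover have "(\<Sum>u\<in>?X. v u * cnj (v u)) = of_real (\<Sum>u\<in>?X. (norm (v u))\<^sup>2)"
    by (simp add: complex_norm_square[symmetric])
  ultimately have "(\<Sum>u\<in>?X. (norm (v u))\<^sup>2) = 0" using of_real_eq_0_iff by metis
  hence "\<forall>u\<in>?X. v u = 0" by (simp add: sum_nonneg_eq_0_iff)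
  hence "v = 0" using off by (auto simp: fun_eq_iff)
  thus False using v(2) by simp
qed

section \<open>Image of the Young symmetrizer under a homomorphism\<close>

lemma hom_space_sum:
  assumes f: "f \<in> hom_space l m" and "finite I" and "\<And>i. i \<in> I \<Longrightarrow> \<tau> i \<in> perms (sum_list m)"
  shows "f (\<lambda>\<pi>. \<Sum>i\<in>I. z i * act_alg (\<tau> i) (young_sym m) \<pi>)
       = (\<lambda>u. \<Sum>i\<in>I. z i * act_tens (sum_list l) (sum_list m) (\<tau> i) (f (young_sym m)) u)"
proof -
  let ?n = "sum_list m" and ?d = "sum_list l" and ?c = "young_sym m"
  have add: "\<And>x y. x \<in> specht m \<Longrightarrow> y \<in> specht m \<Longrightarrow> f (x + y) = f x + f y"
    and scale: "\<And>c x. x \<in> specht m \<Longrightarrow> f (\<lambda>\<pi>. c * x \<pi>) = (\<lambda>u. c * f x u)"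
    and equiv: "\<And>\<sigma> x. \<sigma> \<in> perms ?n \<Longrightarrow> x \<in> specht m \<Longrightarrow> f (act_alg \<sigma> x) = act_tens ?d ?n \<sigma> (f x)"
    using f by (auto simp: hom_space_def Let_def)
  have fin: "finite (perms ?n)" by (simp add: perms_def finite_permutations)
  have spechtI: "(\<lambda>\<pi>. \<Sum>\<sigma>\<in>perms ?n. y \<sigma> * act_alg \<sigma> ?c \<pi>) \<in> specht m" for y
    by (auto simp: specht_def conv_def act_alg_def)
  \<comment> \<open>The coefficient function concentrated at \<sigma> exhibits a single translate as
    an element of the Specht module.\<close>
  have act: "(\<lambda>\<pi>. c * act_alg \<sigma> ?c \<pi>) \<in> specht m" if "\<sigma> \<in> perms ?n" for \<sigma> c
    using spechtI[of "\<lambda>\<rho>. if \<rho> = \<sigma> then c else 0"] fin that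
    by (simp add: if_distrib[of "\<lambda>x. x * _"] cong: if_cong)
  have act1: "act_alg \<sigma> ?c \<in> specht m" if "\<sigma> \<in> perms ?n" for \<sigma>
    using act[OF that, of 1] by simp
  have c: "?c \<in> specht m"
    using act1[of id] by (simp add: perms_def permutes_id act_alg_def)
  have addI: "x + y \<in> specht m" if "x \<in> specht m" "y \<in> specht m" for x y
  proof -
    from that obtain x' y' where "x = conv ?n x' ?c" "y = conv ?n y' ?c"
      by (auto simp: specht_def)
    hence "x + y = conv ?n (\<lambda>\<sigma>. x' \<sigma> + y' \<sigma>) ?c"
      by (auto simp: conv_def fun_eq_iff sum.distrib distrib_right)
    thus ?thesis by (auto simp: specht_def)
  qed
  \<comment> \<open>Additivity of \<open>f\<close> is available only on the Specht module, so the
    induction carries membership of the partial sums along.\<close>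
  have "f (\<lambda>\<pi>. \<Sum>i\<in>I. z i * act_alg (\<tau> i) ?c \<pi>)
       = (\<lambda>u. \<Sum>i\<in>I. z i * act_tens ?d ?n (\<tau> i) (f ?c) u)
     \<and> (\<lambda>\<pi>. \<Sum>i\<in>I. z i * act_alg (\<tau> i) ?c \<pi>) \<in> specht m"
    using assms(2,3)
  proof (induction I rule: finite_induct)
    case empty
    show ?case using scale[OF c, of 0] spechtI[of "\<lambda>_. 0"] by simp
  next
    case (insert i I)
    have i: "\<tau> i \<in> perms ?n" using insert.prems by simp
    have eq: "(\<lambda>\<pi>. \<Sum>i\<in>insert i I. z i * act_alg (\<tau> i) ?c \<pi>)
        = (\<lambda>\<pi>. z i * act_alg (\<tau> i) ?c \<pi>) + (\<lambda>\<pi>. \<Sum>i\<in>I. z i * act_alg (\<tau> i) ?c \<pi>)"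
      using insert.hyps by (simp add: fun_eq_iff)
    have IH: "f (\<lambda>\<pi>. \<Sum>i\<in>I. z i * act_alg (\<tau> i) ?c \<pi>)
       = (\<lambda>u. \<Sum>i\<in>I. z i * act_tens ?d ?n (\<tau> i) (f ?c) u)"
      "(\<lambda>\<pi>. \<Sum>i\<in>I. z i * act_alg (\<tau> i) ?c \<pi>) \<in> specht m"
      using insert.IH insert.prems by auto
    show ?case
      unfolding eq using add[OF act[OF i] IH(2)] addI[OF act[OF i] IH(2)] IH(1)
        scale[OF act1[OF i]] equiv[OF i c] insert.hyps by (auto simp: fun_eq_iff)
  qed
  thus ?thesis by blast
qed

text \<open>The Specht module is the left ideal generated by the Young symmetrizer, so a
  homomorphism is determined by its value there.\<close>

lemma hom_space_generator_nonzero: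
  assumes f: "f \<in> hom_space l m" and "f \<noteq> 0"
  shows "f (young_sym m) \<noteq> 0"
proof
  assume zero: "f (young_sym m) = 0"
  have "f x = 0" for x
  proof (cases "x \<in> specht m")
    case True
    then obtain z where x: "x = (\<lambda>\<pi>. \<Sum>\<sigma>\<in>perms (sum_list m). z \<sigma> * act_alg \<sigma> (young_sym m) \<pi>)"
      by (auto simp: specht_def conv_def act_alg_def)
    have "f x = (\<lambda>u. \<Sum>\<sigma>\<in>perms (sum_list m).
        z \<sigma> * act_tens (sum_list l) (sum_list m) \<sigma> (f (young_sym m)) u)"
      unfolding x by (rule hom_space_sum[OF f]) (auto simp: perms_def finite_permutations)
    also have "\<dots> = 0" by (simp add: zero act_tens_def zero_fun_def)
    finally show ?thesis .
  next
    case False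
    thus ?thesis using f by (auto simp: hom_space_def Let_def)
  qed
  thus False using \<open>f \<noteq> 0\<close> by (auto simp: fun_eq_iff)
qed

lemma hom_space_generator_sym:
  assumes "f \<in> hom_space l m" "u \<in> words (sum_list l) (sum_list m)"
    and xy: "x < sum_list m" "y < sum_list m" "cell_row m x = cell_row m y"
  shows "f (young_sym m) (restrict (transpose x y \<circ> u) {..<sum_list l}) = f (young_sym m) u"
proof -
  have tr: "transpose x y \<in> row_group m" using xy by (simp add: row_group_eq transpose_in_stab_perms)
  hence "transpose x y \<in> perms (sum_list m)" by (simp add: row_group_def)
  with hom_space_sum[OF assms(1), of "{()}" "\<lambda>_. transpose x y" "\<lambda>_. 1"]
  have "f (young_sym m) = act_tens (sum_list l) (sum_list m) (transpose x y) (f (young_sym m))"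
    by (simp add: act_alg_row_group[OF tr])
  from fun_cong[OF this, of u] show ?thesis using assms(2) by (simp add: act_tens_def)
qed

lemma hom_space_generator_garnir:
  assumes "f \<in> hom_space l m" "sorted_wrt (\<ge>) m" and u: "u \<in> words (sum_list l) (sum_list m)"
    and y: "y < sum_list m" "a < cell_row m y"
  shows "f (young_sym m) u + (\<Sum>x | x < sum_list m \<and> cell_row m x = a.
           f (young_sym m) (restrict (transpose x y \<circ> u) {..<sum_list l})) = 0"
proof -
  let ?X = "{x. x < sum_list m \<and> cell_row m x = a}"
  let ?c = "young_sym m"
  have perm: "transpose x y \<in> perms (sum_list m)" if "x \<in> insert y ?X" for x
    using that y by (auto simp: perms_def intro: permutes_swap_id)
  have "f (\<lambda>\<pi>. 0) = (\<lambda>u. \<Sum>x\<in>insert y ?X. 1 * act_tens (sum_list l) (sum_list m) (transpose x y) (f ?c) u)"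
    using hom_space_sum[OF assms(1), of "insert y ?X" "\<lambda>x. transpose x y" "\<lambda>_. 1"] perm
      act_alg_garnir[OF assms(2) y] by simp
  moreover have "f (\<lambda>\<pi>. 0) = (\<lambda>u. 0)"
    using hom_space_sum[OF assms(1), of "{}"] by simp
  ultimately have "(\<Sum>x\<in>insert y ?X. act_tens (sum_list l) (sum_list m) (transpose x y) (f ?c) u) = 0"
    by (metis (no_types, lifting) mult_1 sum.cong)
  thus ?thesis using u y by (simp add: act_tens_def word_restrict)
qed

section \<open>The inequality\<close>

lemma restrict_comp_perm:
  fixes d :: nat
  assumes "r permutes {..<d}"
  shows "restrict g {..<d} \<circ> r = restrict (g \<circ> r) {..<d}"
  using permutes_lessThan_iff[OF assms] by (auto simp: fun_eq_iff)

lemma sum_list_pinter: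
  "sum_list (pinter l m) = (\<Sum>i<min (length l) (length m). min (l ! i) (m ! i))"
  by (simp add: pinter_def sum_list_sum_nth atLeast0LessThan)

lemma extremal_word_count:
  assumes used: "\<And>x. x < sum_list (N # m) \<Longrightarrow> 0 < cell_row (N # m) x \<Longrightarrow> fibre (sum_list l) u x \<noteq> {}"
    and diag: "\<And>x p. x < sum_list (N # m) \<Longrightarrow> 0 < cell_row (N # m) x \<Longrightarrow>
        fibre (sum_list l) u x = {p} \<Longrightarrow> cell_row (N # m) x = Suc (cell_row l p)"
  shows "2 * sum_list m \<le> sum_list l + sum_list (pinter l m)"
proof -
  let ?d = "sum_list l" and ?n = "sum_list (N # m)" and ?ra = "cell_row (N # m)" and ?F = "fibre (sum_list l) u"
  define L where "L = {x. x < ?n \<and> 0 < ?ra x}"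
  define S where "S = {x \<in> L. card (?F x) = 1}"
  have fin: "finite L" "S \<subseteq> L" by (auto simp: L_def S_def)
  have finS: "finite S" using fin finite_subset by blast
  have "card {..<?n} = card ({x. x < ?n \<and> ?ra x = 0} \<union> L)"
    by (rule arg_cong[of _ _ card]) (auto simp: L_def)
  also have "\<dots> = N + card L"
    using card_cell_row[of 0 "N # m"] by (subst card_Un_disjoint) (auto simp: L_def)
  finally have cardL: "card L = sum_list m" by simp
  \<comment> \<open>Labels in \<open>L - S\<close> occupy at least two positions each, and distinct
    labels occupy disjoint sets of positions.\<close>
  have "2 * card L - card S = 2 * card (L - S) + card S"
    using fin finS by (simp add: card_Diff_subset card_mono diff_mult_distrib2)
  also have "\<dots> \<le> (\<Sum>x\<in>L - S. card (?F x)) + (\<Sum>x\<in>S. card (?F x))"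
  proof (rule add_mono)
    have "2 \<le> card (?F x)" if "x \<in> L - S" for x
    proof -
      have "card (?F x) \<noteq> 0" using used[of x] that by (auto simp: L_def)
      moreover have "card (?F x) \<noteq> 1" using that by (simp add: S_def)
      ultimately show ?thesis by linarith
    qed
    thus "2 * card (L - S) \<le> (\<Sum>x\<in>L - S. card (?F x))"
      using sum_mono[of "L - S" "\<lambda>_. 2" "\<lambda>x. card (?F x)"] by simp
    show "card S \<le> (\<Sum>x\<in>S. card (?F x))" by (simp add: S_def)
  qed
  also have "\<dots> = (\<Sum>x\<in>L. card (?F x))"
    using sum.subset_diff[OF fin(2,1), of "\<lambda>x. card (?F x)"] by simp
  also have "\<dots> = card (\<Union>x\<in>L. ?F x)"
    by (rule card_UN_disjoint[symmetric]) (use fin in \<open>auto simp: fibre_def\<close>)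
  also have "\<dots> \<le> card {..<?d}"
    by (rule card_mono) (auto simp: fibre_def)
  finally have bound: "2 * sum_list m \<le> ?d + card S" using cardL by simp
  let ?k = "min (length l) (length m)"
  define T where "T i = {x \<in> S. ?ra x = Suc i}" for i
  have single: "\<exists>p<?d. u p = x \<and> ?ra x = Suc (cell_row l p)" if "x \<in> S" for x
  proof -
    obtain p where p: "?F x = {p}" using \<open>x \<in> S\<close> by (auto simp: S_def card_1_singleton_iff)
    thus ?thesis
      using fibre_eq_singletonD(1,2)[OF p] diag[OF _ _ p] that by (auto simp: S_def L_def)
  qed
  \<comment> \<open>By \<open>diag\<close>, a label of \<open>S\<close> in row \<open>i + 1\<close>
    of \<open>N # m\<close> has its position in row \<open>i\<close> of \<open>l\<close>; hence
    \<open>i\<close> indexes a row of both \<open>l\<close> and \<open>m\<close>.\<close>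
  have "S \<subseteq> (\<Union>i<?k. T i)"
  proof
    fix x assume x: "x \<in> S"
    then obtain p where p: "p < ?d" "?ra x = Suc (cell_row l p)" using single by blast
    have "?ra x < length (N # m)" using x by (intro cell_bounds(1)) (simp add: S_def L_def)
    hence "cell_row l p < ?k" using p cell_bounds(1)[of p l] by simp
    thus "x \<in> (\<Union>i<?k. T i)" using x p by (auto simp: T_def)
  qed
  hence "card S \<le> card (\<Union>i<?k. T i)" using finS by (intro card_mono) (auto simp: T_def)
  also have "\<dots> \<le> (\<Sum>i<?k. card (T i))" by (rule card_UN_le) simp
  also have "\<dots> \<le> (\<Sum>i<?k. min (l ! i) (m ! i))"
  proof (rule sum_mono)
    fix i assume i: "i \<in> {..<?k}"
    have "card (T i) \<le> card {x. x < ?n \<and> ?ra x = Suc i}"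
      by (rule card_mono) (auto simp: T_def S_def L_def)
    also have "\<dots> = m ! i" using card_cell_row[of "Suc i" "N # m"] i by simp
    finally have 1: "card (T i) \<le> m ! i" .
    \<comment> \<open>The positions in row \<open>i\<close> of \<open>l\<close> map onto a set
      containing \<open>T i\<close>, which gives the second bound.\<close>
    have "T i \<subseteq> u ` {p. p < ?d \<and> cell_row l p = i}"
      using single by (fastforce simp: T_def)
    hence "card (T i) \<le> card {p. p < ?d \<and> cell_row l p = i}"
      by (intro surj_card_le) auto
    also have "\<dots> = l ! i" using card_cell_row[of i l] i by simp
    finally show "card (T i) \<le> min (l ! i) (m ! i)" using 1 by simp
  qed
  finally show ?thesis using bound by (simp add: sum_list_pinter)
qed

lemma hom_space_nonzero_bound:
  assumes l: "sorted_wrt (\<ge>) l" and m: "sorted_wrt (\<ge>) (N # m)"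
    and f: "f \<in> hom_space l (N # m)" "f \<noteq> 0"
  shows "2 * sum_list m \<le> sum_list l + sum_list (pinter l m)"
proof -
  let ?d = "sum_list l" and ?n = "sum_list (N # m)"
  define v where "v = f (young_sym (N # m))"
  have v0: "v \<noteq> 0" unfolding v_def by (rule hom_space_generator_nonzero[OF f])
  \<comment> \<open>Members of \<open>hom_space\<close> vanish off the Specht module, so a nonzero
    value certifies membership.\<close>
  have "young_sym (N # m) \<in> specht (N # m)"
    using f hom_space_generator_nonzero[OF f] by (auto simp: hom_space_def Let_def)
  hence v: "v \<in> schur l ?n" using f(1) unfolding v_def hom_space_def Let_def by blast
  define w where "w u = (\<Sum>r\<in>row_group l. v (u \<circ> r))" for u
  obtain u0 where u0: "u0 \<in> words ?d ?n" "w u0 \<noteq> 0"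
    using schur_row_sum_nonzero[OF v v0] unfolding w_def by blast
  have rowp: "r permutes {..<?d}" if "r \<in> row_group l" for r
    using that by (simp add: row_group_eq stab_perms_def)
  \<comment> \<open>Label permutations compose on the left of a word and position permutations on
    the right. They commute, so the label relations of \<open>v\<close> pass to its row
    symmetrization \<open>w\<close>.\<close>
  have w_swap: "w (restrict (g \<circ> u) {..<?d}) = (\<Sum>r\<in>row_group l. v (restrict (g \<circ> (u \<circ> r)) {..<?d}))" for g u
    unfolding w_def by (rule sum.cong) (simp_all add: restrict_comp_perm[OF rowp] o_assoc)
  obtain u where "u \<in> words ?d ?n"
    and used: "\<And>x. x < ?n \<Longrightarrow> 0 < cell_row (N # m) x \<Longrightarrow> fibre ?d u x \<noteq> {}"
    and diag: "\<And>x p. x < ?n \<Longrightarrow> 0 < cell_row (N # m) x \<Longrightarrow> fibre ?d u x = {p} \<Longrightarrow>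
        cell_row (N # m) x = Suc (cell_row l p)"
  proof (rule extremal_word[where w = w and ra = "cell_row (N # m)" and rp = "cell_row l" and d = ?d and n = ?n])
    show "u0 \<in> words ?d ?n" "w u0 \<noteq> 0" by (fact u0)+
  next
    fix u x y
    assume u: "u \<in> words ?d ?n" and xy: "x < ?n" "y < ?n" "cell_row (N # m) x = cell_row (N # m) y"
    have "v (restrict (transpose x y \<circ> (u \<circ> r)) {..<?d}) = v (u \<circ> r)" if "r \<in> row_group l" for r
      unfolding v_def
      by (rule hom_space_generator_sym[OF f(1) words_comp_perm[OF u rowp[OF that]] xy])
    thus "w (restrict (transpose x y \<circ> u) {..<?d}) = w u"
      unfolding w_swap by (simp add: w_def)
  next
    fix u y a
    assume u: "u \<in> words ?d ?n" and y: "y < ?n" "a < cell_row (N # m) y"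
    have "w u + (\<Sum>x | x < ?n \<and> cell_row (N # m) x = a. w (restrict (transpose x y \<circ> u) {..<?d}))
        = (\<Sum>r\<in>row_group l. v (u \<circ> r) + (\<Sum>x | x < ?n \<and> cell_row (N # m) x = a.
              v (restrict (transpose x y \<circ> (u \<circ> r)) {..<?d})))"
      unfolding w_swap by (subst sum.swap) (simp add: w_def sum.distrib)
    also have "\<dots> = 0"
      unfolding v_def
      by (intro sum.neutral ballI hom_space_generator_garnir[OF f(1) m words_comp_perm[OF u rowp] y])
    finally show "w u + (\<Sum>x | x < ?n \<and> cell_row (N # m) x = a. w (restrict (transpose x y \<circ> u) {..<?d})) = 0" .
  next
    fix u p q
    assume pq: "p < ?d" "q < ?d" "cell_row l p = cell_row l q"
    hence "transpose p q \<in> row_group l" by (simp add: row_group_eq transpose_in_stab_perms)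
    thus "w (u \<circ> transpose p q) = w u"
      using sum_stab_perms_comp_left[of "transpose p q" ?d "cell_row l" "\<lambda>r. v (u \<circ> r)"]
      by (simp add: w_def row_group_eq o_assoc)
  next
    fix u q i
    assume u: "u \<in> words ?d ?n" and q: "q < ?d" "i < cell_row l q"
    \<comment> \<open>The second use of \<open>garnir_relation\<close>: here the alternating
      function is \<open>v\<close> along the position rearrangements of \<open>u\<close>.\<close>
    have "(\<Sum>p\<in>insert q {p. p < ?d \<and> cell_row l p = i}. w (u \<circ> transpose p q)) = 0"
    proof (rule garnir_relation[OF l q, where \<Phi> = "\<lambda>g. v (u \<circ> g)" and W = "\<lambda>g. w (u \<circ> g)"])
      fix g s t
      assume "g permutes {..<?d}" "s < ?d" "t < ?d" "s \<noteq> t" "cell_col l s = cell_col l t"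
      thus "v (u \<circ> (g \<circ> transpose s t)) = - v (u \<circ> g)"
        using schur_alternating[OF v words_comp_perm[OF u]] by (simp add: o_assoc)
    qed (simp add: w_def o_assoc)
    thus "w u + (\<Sum>p | p < ?d \<and> cell_row l p = i. w (u \<circ> transpose p q)) = 0"
      using q by simp
  qed (rule that)
  show ?thesis by (rule extremal_word_count[OF used diag])
qed

section \<open>Vanishing of the coefficients and of their limit\<close>

lemma restr_coeff_eq_0:
  assumes "hom_space l m \<subseteq> {0}"
  shows "restr_coeff l m = 0"
proof -
  interpret vector_space "\<lambda>(c::complex) (f :: ((nat \<Rightarrow> nat) \<Rightarrow> complex) \<Rightarrow> ((nat \<Rightarrow> nat) \<Rightarrow> complex)). (\<lambda>x u. c * f x u)"
    by unfold_locales (auto simp: fun_eq_iff algebra_simps)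
  \<comment> \<open>The empty set already spans the zero space.\<close>
  have "dim (hom_space l m) \<le> card ({} :: (((nat \<Rightarrow> nat) \<Rightarrow> complex) \<Rightarrow> ((nat \<Rightarrow> nat) \<Rightarrow> complex)) set)"
    by (rule dim_le_card) (use assms in auto)
  thus ?thesis by (simp add: restr_coeff_def)
qed

theorem theorem1p3:
  fixes lam mu :: "nat list"
  assumes "is_partition lam" and "is_partition mu"
    and "stable_coeff lam mu > 0"
  shows "int (sum_list (pinter lam mu)) \<ge> 2 * int (sum_list mu) - int (sum_list lam)"
proof (rule ccontr)
  assume neg: "\<not> ?thesis"
  have "restr_coeff lam (pad_part n mu) = 0" if n: "2 * sum_list mu \<le> n" for n
  proof (rule restr_coeff_eq_0, rule ccontr)
    assume "\<not> hom_space lam (pad_part n mu) \<subseteq> {0}"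
    then obtain f where f: "f \<in> hom_space lam (pad_part n mu)" "f \<noteq> 0" by blast
    \<comment> \<open>Each part is at most |\<mu>|, and \<open>n\<close> is at least twice that, so
      the prepended first row is the longest and the padded list is weakly decreasing.\<close>
    have "k \<le> n - sum_list mu" if "k \<in> set mu" for k
      using member_le_sum_list[OF that] n by linarith
    hence "sorted_wrt (\<ge>) ((n - sum_list mu) # mu)"
      using assms(2) by (simp add: is_partition_def)
    with f assms(1) have "2 * sum_list mu \<le> sum_list lam + sum_list (pinter lam mu)"
      by (intro hom_space_nonzero_bound[of lam "n - sum_list mu" mu f])
        (auto simp: is_partition_def pad_part_def)
    thus False using neg by linarith
  qed
  hence "\<forall>\<^sub>F n in sequentially. real (restr_coeff lam (pad_part n mu)) = 0"
    by (auto intro: eventually_sequentiallyI[of "2 * sum_list mu"])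
  hence "(\<lambda>n. real (restr_coeff lam (pad_part n mu))) \<longlonglongrightarrow> 0"
    by (rule tendsto_eventually)
  hence "stable_coeff lam mu = 0" unfolding stable_coeff_def by (rule limI)
  thus False using assms(3) by simp
qed

end
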